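(* Let $\boldsymbol{s}$ be a centered isotropic sub-Gaussian random vector in $\mathbb{R}^d$, let $\boldsymbol{z}_0\in\mathbb{R}^d\setminus\{\boldsymbol{0}\}$, and let $y = g(\langle\boldsymbol{s},\boldsymbol{z}_0\rangle)$ be a sub-Gaussian random variable, where $g\colon\mathbb{R}\to\mathbb{R}$ is a measurable function which may be random (independently of $\boldsymbol{s}$). Set $T := \operatorname{span}\{\boldsymbol{z}_0\}$. Then $\boldsymbol{z}^\natural := \mu\boldsymbol{z}_0\in T$ with $$ \mu := \frac{1}{\|\boldsymbol{z}_0\|_2^2}\,\mathbb{E}[g(\langle\boldsymbol{s},\boldsymbol{z}_0\rangle)\langle\boldsymbol{s},\boldsymbol{z}_0\rangle] $$ minimizes the mismatch covariance $\rho$ on $T$, and we have $$ \rho(\boldsymbol{z}^\natural) = \big\|\mathbb{E}[g(\langle\boldsymbol{s},\boldsymbol{z}_0\rangle)\,\boldsymbol{P}_{\boldsymbol{z}_0}^\perp\boldsymbol{s}]\big\|_2 . $$ In particular, if $\boldsymbol{s}\sim\mathcal{N}(\boldsymbol{0},\boldsymbol{I}_d)$, we have $\rho(\boldsymbol{z}^\natural)=0$.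
   Context: A real random variable $v$ is sub-Gaussian if $\|v\|_{\psi_2} := \sup_{q\ge 1} q^{-1/2}(\mathbb{E}|v|^q)^{1/q}<\infty$; a random vector $\boldsymbol{v}$ in $\mathbb{R}^d$ is sub-Gaussian if $\sup_{\boldsymbol{u}\in\mathbb{S}^{d-1}}\|\langle\boldsymbol{v},\boldsymbol{u}\rangle\|_{\psi_2}<\infty$, centered if $\mathbb{E}[\boldsymbol{v}]=\boldsymbol{0}$, and isotropic if $\mathbb{E}[\boldsymbol{v}\boldsymbol{v}^{\mathsf T}]=\boldsymbol{I}_d$. The mismatch covariance of $\boldsymbol{z}\in\mathbb{R}^d$ is $\rho(\boldsymbol{z}) := \|\mathbb{E}[(y-\langle\boldsymbol{s},\boldsymbol{z}\rangle)\boldsymbol{s}]\|_2$. $\boldsymbol{P}_{\boldsymbol{z}_0}^\perp := \boldsymbol{I}_d-\boldsymbol{P}_{\boldsymbol{z}_0}$, where $\boldsymbol{P}_{\boldsymbol{z}_0}$ is the orthogonal projection onto $\operatorname{span}\{\boldsymbol{z}_0\}$. That $g$ may be random, independently of $\boldsymbol{s}$, means that $g$ may additionally depend measurably on an auxiliary random element independent of $\boldsymbol{s}$. *)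

theory Defs
  imports "HOL-Probability.Probability"
begin

text \<open>
  \<open>Lp_norm M q v\<close> is \<open>(E|v|^q)^(1/q)\<close>, with value \<open>\<infinity>\<close> if the \<open>q\<close>-th absolute moment is infinite.
  Extended values are used so that the suprema below are genuine suprema; a Bochner integral
  would silently be \<open>0\<close> for a divergent moment.
\<close>

definition Lp_norm :: "'w measure \<Rightarrow> real \<Rightarrow> ('w \<Rightarrow> real) \<Rightarrow> ennreal" where
  "Lp_norm M q v =
    (let m = (\<integral>\<^sup>+\<omega>. ennreal (\<bar>v \<omega>\<bar> powr q) \<partial>M)
     in if m = \<infinity> then \<infinity> else ennreal (enn2real m powr (1 / q)))"

definition psi2_norm :: "'w measure \<Rightarrow> ('w \<Rightarrow> real) \<Rightarrow> ennreal" where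
  "psi2_norm M v = (SUP q\<in>{1..}. ennreal (q powr (- 1 / 2)) * Lp_norm M q v)"

definition sub_gaussian :: "'w measure \<Rightarrow> ('w \<Rightarrow> real) \<Rightarrow> bool" where
  "sub_gaussian M v \<longleftrightarrow> v \<in> borel_measurable M \<and> psi2_norm M v < \<infinity>"

definition sub_gaussian_vector :: "'w measure \<Rightarrow> ('w \<Rightarrow> real ^ 'd) \<Rightarrow> bool" where
  "sub_gaussian_vector M v \<longleftrightarrow>
    v \<in> borel_measurable M \<and> (SUP u\<in>sphere 0 1. psi2_norm M (\<lambda>\<omega>. v \<omega> \<bullet> u)) < \<infinity>"

definition centered :: "'w measure \<Rightarrow> ('w \<Rightarrow> real ^ 'd) \<Rightarrow> bool" where
  "centered M v \<longleftrightarrow> integrable M v \<and> (\<integral>\<omega>. v \<omega> \<partial>M) = 0"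

definition isotropic :: "'w measure \<Rightarrow> ('w \<Rightarrow> real ^ 'd) \<Rightarrow> bool" where
  "isotropic M v \<longleftrightarrow>
    integrable M (\<lambda>\<omega>. (\<chi> i j. v \<omega> $ i * v \<omega> $ j) :: real ^ 'd ^ 'd) \<and>
    (\<integral>\<omega>. (\<chi> i j. v \<omega> $ i * v \<omega> $ j) \<partial>M) = (mat 1 :: real ^ 'd ^ 'd)"

text \<open>
  The library's \<open>indep_var\<close> forces both random elements to take values in the same type; this is
  its definition for two random elements with values in possibly different types.
\<close>

definition indep_elements ::
  "'w measure \<Rightarrow> 'a measure \<Rightarrow> ('w \<Rightarrow> 'a) \<Rightarrow> 'b measure \<Rightarrow> ('w \<Rightarrow> 'b) \<Rightarrow> bool" where
  "indep_elements M A X B Y \<longleftrightarrow>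
    X \<in> measurable M A \<and> Y \<in> measurable M B \<and>
    prob_space.indep_set M
      {X -` S \<inter> space M | S. S \<in> sets A} {Y -` S \<inter> space M | S. S \<in> sets B}"

definition mismatch_covariance ::
  "'w measure \<Rightarrow> ('w \<Rightarrow> real ^ 'd) \<Rightarrow> ('w \<Rightarrow> real) \<Rightarrow> real ^ 'd \<Rightarrow> real" where
  "mismatch_covariance M s y z = norm (\<integral>\<omega>. (y \<omega> - s \<omega> \<bullet> z) *\<^sub>R s \<omega> \<partial>M)"

text \<open>Orthogonal projection onto a subspace \<open>S\<close>; existence and uniqueness hold for subspaces only.\<close>

definition orth_proj :: "(real ^ 'd) set \<Rightarrow> real ^ 'd \<Rightarrow> real ^ 'd" where
  "orth_proj S x = (THE p. p \<in> S \<and> (\<forall>v\<in>S. orthogonal (x - p) v))"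

definition orth_proj_compl :: "(real ^ 'd) set \<Rightarrow> real ^ 'd \<Rightarrow> real ^ 'd" where
  "orth_proj_compl S x = x - orth_proj S x"

definition standard_gaussian_vector :: "'w measure \<Rightarrow> ('w \<Rightarrow> real ^ 'd) \<Rightarrow> bool" where
  "standard_gaussian_vector M v \<longleftrightarrow>
    distributed M lborel v
      (\<lambda>x. ennreal ((2 * pi) powr (- real CARD('d) / 2) * exp (- (norm x)\<^sup>2 / 2)))"

end

theory Submission
  imports Defs
begin

text \<open>
  By isotropy \<open>E[\<langle>s, z\<rangle> s] = z\<close>, so the mismatch covariance is a distance,
  \<open>\<rho>(z) = \<parallel>E[y s] - z\<parallel>\<close> (\<open>mismatch_covariance_eq_dist\<close>). The vector \<open>y s\<close> is integrable
  because both factors are square integrable: \<open>y\<close> as a sub-Gaussian variable, \<open>s\<close> because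
  \<open>E\<parallel>s\<parallel>\<^sup>2\<close> is the trace of \<open>E[s s\<^sup>T]\<close>. The minimizer of \<open>\<rho>\<close> over the line spanned by \<open>z0\<close> is the
  orthogonal projection of \<open>E[y s]\<close>, which is \<open>\<mu> z0\<close>, and the minimal value is the norm of the
  complementary projection of \<open>E[y s]\<close>. That projection is linear and can be moved inside the
  expectation.

  For Gaussian \<open>s\<close>, let \<open>R\<close> be the reflection that fixes \<open>z0\<close> and negates the orthogonal
  complement of \<open>z0\<close>. The Gaussian law is invariant under the orthogonal map \<open>R\<close>, and independence
  of \<open>s\<close> and \<open>\<xi>\<close> lifts this to the joint law: \<open>(R s, \<xi>)\<close> and \<open>(s, \<xi>)\<close> are equally distributed.
  Replacing \<open>s\<close> by \<open>R s\<close> leaves \<open>y\<close> unchanged, because \<open>\<langle>R s, z0\<rangle> = \<langle>s, z0\<rangle>\<close>, but negates the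
  component of \<open>s\<close> orthogonal to \<open>z0\<close>. Hence the expectation of \<open>y\<close> times that component equals
  its own negative (\<open>gaussian_integral_orth_proj_compl_line_zero\<close>). The analytic input is the
  invariance of Lebesgue measure under orthogonal maps
  (\<open>lborel_distr_orthogonal_transformation\<close>).
\<close>

section \<open>Second moments\<close>

text \<open>The second moment is controlled by the term \<open>q = 2\<close> of the supremum.\<close>

lemma sub_gaussian_square_integrable:
  assumes "sub_gaussian M v"
  shows "integrable M (\<lambda>\<omega>. (v \<omega>)\<^sup>2)"
proof -
  have meas [measurable]: "v \<in> borel_measurable M"
    and fin: "psi2_norm M v < \<infinity>"
    using assms by (auto simp: sub_gaussian_def)
  have "ennreal (2 powr (- 1 / 2)) * Lp_norm M 2 v \<le> psi2_norm M v"
    unfolding psi2_norm_def by (rule SUP_upper) simp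
  then have "ennreal (2 powr (- 1 / 2)) * Lp_norm M 2 v < \<infinity>"
    using fin by (rule order.strict_trans1)
  then have "Lp_norm M 2 v \<noteq> \<infinity>"
    by (auto simp: ennreal_mult_top)
  then have "(\<integral>\<^sup>+\<omega>. ennreal (\<bar>v \<omega>\<bar> powr 2) \<partial>M) \<noteq> \<infinity>"
    by (auto simp: Lp_norm_def Let_def)
  then have "(\<integral>\<^sup>+\<omega>. ennreal (norm ((v \<omega>)\<^sup>2)) \<partial>M) < \<infinity>"
    by (simp add: less_top)
  then show ?thesis
    by (intro integrableI_bounded) auto
qed

lemma integrable_scaleR_of_squares:
  fixes f :: "'a \<Rightarrow> real" and v :: "'a \<Rightarrow> 'b::{banach, second_countable_topology}"
  assumes [measurable]: "f \<in> borel_measurable M" "v \<in> borel_measurable M"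
    and f: "integrable M (\<lambda>x. (f x)\<^sup>2)" and v: "integrable M (\<lambda>x. (norm (v x))\<^sup>2)"
  shows "integrable M (\<lambda>x. f x *\<^sub>R v x)"
proof (rule Bochner_Integration.integrable_bound)
  show "integrable M (\<lambda>x. (f x)\<^sup>2 + (norm (v x))\<^sup>2)"
    using f v by simp
  show "AE x in M. norm (f x *\<^sub>R v x) \<le> norm ((f x)\<^sup>2 + (norm (v x))\<^sup>2)"
  proof (rule AE_I2)
    fix x
    have "2 * (\<bar>f x\<bar> * norm (v x)) \<le> (f x)\<^sup>2 + (norm (v x))\<^sup>2"
      using sum_squares_bound[of "\<bar>f x\<bar>" "norm (v x)"] by (simp add: mult.assoc)
    moreover have "0 \<le> \<bar>f x\<bar> * norm (v x)"
      by simp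
    ultimately show "norm (f x *\<^sub>R v x) \<le> norm ((f x)\<^sup>2 + (norm (v x))\<^sup>2)"
      unfolding norm_scaleR real_norm_def by linarith
  qed
qed simp

text \<open>The trace is a bounded linear map, and the trace of \<open>v v\<^sup>T\<close> is \<open>\<parallel>v\<parallel>\<^sup>2\<close>.\<close>

lemma isotropic_norm_square_integrable:
  fixes v :: "'w \<Rightarrow> real ^ 'd"
  assumes "isotropic M v"
  shows "integrable M (\<lambda>\<omega>. (norm (v \<omega>))\<^sup>2)"
proof -
  have int: "integrable M (\<lambda>\<omega>. (\<chi> i j. v \<omega> $ i * v \<omega> $ j) :: real ^ 'd ^ 'd)"
    using assms by (simp add: isotropic_def)
  have bl: "bounded_linear (\<lambda>A :: real ^ 'd ^ 'd. \<Sum>i\<in>UNIV. A $ i $ i)"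
    by (intro bounded_linear_sum bounded_linear_compose[OF bounded_linear_vec_nth]
        bounded_linear_vec_nth)
  show ?thesis
    using integrable_bounded_linear[OF bl int]
    by (simp add: power2_norm_eq_inner inner_vec_def)
qed

text \<open>Evaluation at \<open>z\<close> is a bounded linear map on matrices and sends \<open>v v\<^sup>T\<close> to \<open>\<langle>v, z\<rangle> v\<close>, so it
  sends \<open>E[v v\<^sup>T] = I\<close> to \<open>E[\<langle>v, z\<rangle> v]\<close>.\<close>

lemma isotropic_integral_inner_scaleR:
  fixes v :: "'w \<Rightarrow> real ^ 'd"
  assumes "isotropic M v"
  shows "integrable M (\<lambda>\<omega>. (v \<omega> \<bullet> z) *\<^sub>R v \<omega>)"
    and "(\<integral>\<omega>. (v \<omega> \<bullet> z) *\<^sub>R v \<omega> \<partial>M) = z"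
proof -
  have int: "integrable M (\<lambda>\<omega>. (\<chi> i j. v \<omega> $ i * v \<omega> $ j) :: real ^ 'd ^ 'd)"
    and eq: "(\<integral>\<omega>. (\<chi> i j. v \<omega> $ i * v \<omega> $ j) \<partial>M) = (mat 1 :: real ^ 'd ^ 'd)"
    using assms by (simp_all add: isotropic_def)
  have bl: "bounded_linear (\<lambda>A :: real ^ 'd ^ 'd. A *v z)"
    unfolding linear_conv_bounded_linear[symmetric]
    by (rule linearI) (simp_all add: matrix_vector_mult_add_rdistrib scaleR_matrix_vector_assoc)
  have outer: "(\<chi> i j. v \<omega> $ i * v \<omega> $ j) *v z = (v \<omega> \<bullet> z) *\<^sub>R v \<omega>" for \<omega>
    by (simp add: vec_eq_iff matrix_vector_mult_def inner_vec_def sum_distrib_left sum_distrib_right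
        mult_ac)
  show "integrable M (\<lambda>\<omega>. (v \<omega> \<bullet> z) *\<^sub>R v \<omega>)"
    using integrable_bounded_linear[OF bl int] by (simp add: outer)
  show "(\<integral>\<omega>. (v \<omega> \<bullet> z) *\<^sub>R v \<omega> \<partial>M) = z"
    using integral_bounded_linear[OF bl int] by (simp add: outer eq)
qed

text \<open>This turns minimizing the mismatch covariance over a subspace into projecting \<open>E[y s]\<close> onto
  it.\<close>

lemma mismatch_covariance_eq_dist:
  fixes s :: "'w \<Rightarrow> real ^ 'd"
  assumes "isotropic M s" and "integrable M (\<lambda>\<omega>. y \<omega> *\<^sub>R s \<omega>)"
  shows "mismatch_covariance M s y z = norm ((\<integral>\<omega>. y \<omega> *\<^sub>R s \<omega> \<partial>M) - z)"
  using assms isotropic_integral_inner_scaleR[OF assms(1), of z]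
  by (simp add: mismatch_covariance_def scaleR_diff_left)

section \<open>Projection onto a line\<close>

lemma orth_proj_line:
  fixes z :: "real ^ 'd"
  assumes "z \<noteq> 0"
  shows "orth_proj (span {z}) x = ((x \<bullet> z) / (norm z)\<^sup>2) *\<^sub>R z"
  unfolding orth_proj_def
proof (rule the_equality)
  show "((x \<bullet> z) / (norm z)\<^sup>2) *\<^sub>R z \<in> span {z} \<and>
    (\<forall>v\<in>span {z}. orthogonal (x - ((x \<bullet> z) / (norm z)\<^sup>2) *\<^sub>R z) v)"
    using assms by (auto simp: span_singleton orthogonal_def inner_diff_left power2_norm_eq_inner)
next
  fix p assume p: "p \<in> span {z} \<and> (\<forall>v\<in>span {z}. orthogonal (x - p) v)"
  then obtain k where k: "p = k *\<^sub>R z"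
    by (auto simp: span_singleton)
  have "z \<in> span {z}"
    by (simp add: span_base)
  then have "x \<bullet> z = k * (norm z)\<^sup>2"
    using p by (auto simp: k orthogonal_def inner_diff_left power2_norm_eq_inner)
  then show "p = ((x \<bullet> z) / (norm z)\<^sup>2) *\<^sub>R z"
    using assms by (simp add: k)
qed

lemma bounded_linear_orth_proj_compl_line:
  fixes z :: "real ^ 'd"
  assumes "z \<noteq> 0"
  shows "bounded_linear (orth_proj_compl (span {z}))"
  unfolding linear_conv_bounded_linear[symmetric]
  by (rule linearI)
    (simp_all add: orth_proj_compl_def orth_proj_line[OF assms] inner_add_left add_divide_distrib
      scaleR_add_left scaleR_diff_right)

lemma norm_orth_proj_compl_line_le:
  fixes z :: "real ^ 'd"
  assumes "z \<noteq> 0" "p \<in> span {z}"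
  shows "norm (orth_proj_compl (span {z}) x) \<le> norm (x - p)"
proof -
  define a where "a = orth_proj (span {z}) x"
  obtain k where k: "p = k *\<^sub>R z"
    using assms(2) by (auto simp: span_singleton)
  have "orthogonal (x - a) (a - p)"
    using assms(1)
    by (simp add: a_def k orth_proj_line orthogonal_def inner_diff_left inner_diff_right
        power2_norm_eq_inner)
  then have "(norm (x - p))\<^sup>2 = (norm (x - a))\<^sup>2 + (norm (a - p))\<^sup>2"
    using norm_add_Pythagorean[of "x - a" "a - p"] by simp
  then have "(norm (x - a))\<^sup>2 \<le> (norm (x - p))\<^sup>2"
    by simp
  then show ?thesis
    by (simp add: orth_proj_compl_def a_def power2_le_iff_abs_le)
qed

section \<open>Invariance of the joint law under reflections\<close>

lemma borel_measurable_orthogonal_transformation: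
  fixes f :: "'a::euclidean_space \<Rightarrow> 'a"
  assumes "orthogonal_transformation f"
  shows "f \<in> borel_measurable borel"
  using orthogonal_transformation_linear[OF assms]
  by (simp add: borel_measurable_continuous_onI linear_continuous_on linear_conv_bounded_linear)

lemma nn_integral_lborel_translation:
  fixes h :: "'a::euclidean_space \<Rightarrow> ennreal"
  assumes [measurable]: "h \<in> borel_measurable borel"
  shows "(\<integral>\<^sup>+x. h (c + x) \<partial>lborel) = (\<integral>\<^sup>+x. h x \<partial>lborel)"
proof -
  have "(\<integral>\<^sup>+x. h x \<partial>lborel) = (\<integral>\<^sup>+x. h x \<partial>distr lborel borel ((+) c))"
    by (simp add: lborel_distr_plus)
  also have "\<dots> = (\<integral>\<^sup>+x. h (c + x) \<partial>lborel)"
    by (rule nn_integral_distr) measurable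
  finally show ?thesis ..
qed

text \<open>
  The image of Lebesgue measure under \<open>f\<close> is again translation invariant, so it is a constant
  multiple of Lebesgue measure, and the constant is \<open>1\<close> because \<open>f\<close> preserves the unit ball \<open>B\<close>.
  The usual double-integral proof that an invariant measure is unique yields both at once. Let
  \<open>h\<close> be the indicator of \<open>B\<close>, so that \<open>h(- f x) = h(x)\<close>, and \<open>k\<close> that of a Borel set. Translations
  in \<open>y\<close>, then \<open>x\<close>, then \<open>y\<close>, with the order of integration swapped in between, turn
  \<open>\<integral>\<integral> k(f x) h(y) dy dx\<close> into \<open>\<integral>\<integral> k(y) h(x) dy dx\<close>, and \<open>\<integral> h\<close> cancels because it is positive
  and finite.
\<close>

lemma lborel_distr_orthogonal_transformation:
  fixes f :: "'a::euclidean_space \<Rightarrow> 'a"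
  assumes f: "orthogonal_transformation f"
  shows "distr lborel borel f = lborel"
proof (rule measure_eqI)
  have [measurable]: "f \<in> borel_measurable borel"
    by (rule borel_measurable_orthogonal_transformation[OF f])
  have lin: "linear f"
    by (rule orthogonal_transformation_linear[OF f])
  define h :: "'a \<Rightarrow> ennreal" where "h = indicator (ball 0 1)"
  have [measurable]: "h \<in> borel_measurable borel"
    unfolding h_def by (intro borel_measurable_indicator) simp
  have h_f: "h (- f x) = h x" for x
    using orthogonal_transformation_norm[OF f, of x] by (simp add: h_def indicator_def)
  have h_int: "(\<integral>\<^sup>+x. h x \<partial>lborel) = emeasure lborel (ball (0 :: 'a) 1)"
    by (simp add: h_def)
  fix A assume "A \<in> sets (distr lborel borel f)"
  then have [measurable]: "A \<in> sets borel"
    by simp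
  define k :: "'a \<Rightarrow> ennreal" where "k = indicator A"
  have [measurable]: "k \<in> borel_measurable borel"
    unfolding k_def by measurable
  have "(\<integral>\<^sup>+x. k (f x) \<partial>lborel) * (\<integral>\<^sup>+y. h y \<partial>lborel)
      = (\<integral>\<^sup>+x. (\<integral>\<^sup>+y. k (f x) * h y \<partial>lborel) \<partial>lborel)"
    by (simp add: nn_integral_cmult nn_integral_multc)
  also have "\<dots> = (\<integral>\<^sup>+x. (\<integral>\<^sup>+y. k (f x) * h (- f x + y) \<partial>lborel) \<partial>lborel)"
    by (intro nn_integral_cong nn_integral_lborel_translation[symmetric]) measurable
  also have "\<dots> = (\<integral>\<^sup>+y. (\<integral>\<^sup>+x. k (f x) * h (- f x + y) \<partial>lborel) \<partial>lborel)"
    by (rule lborel_pair.Fubini') measurable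
  also have "\<dots> = (\<integral>\<^sup>+y. (\<integral>\<^sup>+x. k (f x + y) * h x \<partial>lborel) \<partial>lborel)"
  proof (rule nn_integral_cong)
    fix y
    \<comment> \<open>Translating \<open>x\<close> by \<open>c\<close> moves \<open>f x\<close> by \<open>y\<close>, which cancels the \<open>y\<close> in the argument of \<open>h\<close>.\<close>
    obtain c where c: "y = f c"
      using orthogonal_transformation_surj[OF f] by (metis surjD)
    have "(\<integral>\<^sup>+x. k (f x) * h (- f x + y) \<partial>lborel)
        = (\<integral>\<^sup>+x. k (f (c + x)) * h (- f (c + x) + y) \<partial>lborel)"
      by (rule nn_integral_lborel_translation[symmetric]) measurable
    also have "\<dots> = (\<integral>\<^sup>+x. k (f x + y) * h x \<partial>lborel)"
      by (simp add: c linear_add[OF lin] h_f add.commute)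
    finally show "(\<integral>\<^sup>+x. k (f x) * h (- f x + y) \<partial>lborel)
        = (\<integral>\<^sup>+x. k (f x + y) * h x \<partial>lborel)" .
  qed
  also have "\<dots> = (\<integral>\<^sup>+x. (\<integral>\<^sup>+y. k (f x + y) * h x \<partial>lborel) \<partial>lborel)"
    by (rule lborel_pair.Fubini') measurable
  also have "\<dots> = (\<integral>\<^sup>+x. (\<integral>\<^sup>+y. k y * h x \<partial>lborel) \<partial>lborel)"
    by (intro nn_integral_cong nn_integral_lborel_translation) measurable
  also have "\<dots> = (\<integral>\<^sup>+y. k y \<partial>lborel) * (\<integral>\<^sup>+x. h x \<partial>lborel)"
    by (simp add: nn_integral_cmult nn_integral_multc)
  finally have "(\<integral>\<^sup>+x. k (f x) \<partial>lborel) * emeasure lborel (ball (0 :: 'a) 1)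
      = (\<integral>\<^sup>+y. k y \<partial>lborel) * emeasure lborel (ball (0 :: 'a) 1)"
    by (simp only: h_int)
  moreover have "0 < emeasure lborel (ball (0 :: 'a) 1)" "emeasure lborel (ball (0 :: 'a) 1) < \<infinity>"
    using emeasure_lborel_ball_finite[of "0 :: 'a" 1]
    by (auto simp: emeasure_ball unit_ball_vol_pos)
  ultimately have "(\<integral>\<^sup>+x. k (f x) \<partial>lborel) = (\<integral>\<^sup>+y. k y \<partial>lborel)"
    by (metis mult_divide_eq_ennreal less_irrefl infinity_ennreal_def)
  moreover have "(\<integral>\<^sup>+x. k (f x) \<partial>lborel) = (\<integral>\<^sup>+y. k y \<partial>distr lborel borel f)"
    by (rule nn_integral_distr[symmetric]) measurable
  ultimately show "emeasure (distr lborel borel f) A = emeasure lborel A"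
    by (simp add: k_def)
qed simp

lemma indep_elements_joint_distr:
  assumes "prob_space M" and "indep_elements M A X B Y"
  shows "distr M (A \<Otimes>\<^sub>M B) (\<lambda>\<omega>. (X \<omega>, Y \<omega>)) = distr M A X \<Otimes>\<^sub>M distr M B Y"
proof (rule sym, rule pair_measure_eqI)
  interpret prob_space M by fact
  have [measurable]: "X \<in> measurable M A" "Y \<in> measurable M B"
    and ind: "indep_set {X -` S \<inter> space M | S. S \<in> sets A} {Y -` S \<inter> space M | S. S \<in> sets B}"
    using assms(2) by (auto simp: indep_elements_def)
  interpret X: prob_space "distr M A X" by (rule prob_space_distr) simp
  interpret Y: prob_space "distr M B Y" by (rule prob_space_distr) simp
  show "sigma_finite_measure (distr M A X)" "sigma_finite_measure (distr M B Y)"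
    by unfold_locales
  show "sets (distr M A X \<Otimes>\<^sub>M distr M B Y) = sets (distr M (A \<Otimes>\<^sub>M B) (\<lambda>\<omega>. (X \<omega>, Y \<omega>)))"
    by (simp cong: sets_pair_measure_cong)
  fix S S' assume "S \<in> sets (distr M A X)" "S' \<in> sets (distr M B Y)"
  then have [measurable]: "S \<in> sets A" "S' \<in> sets B"
    by simp_all
  have "prob ((X -` S \<inter> space M) \<inter> (Y -` S' \<inter> space M))
      = prob (X -` S \<inter> space M) * prob (Y -` S' \<inter> space M)"
    by (rule indep_setD[OF ind]) auto
  moreover have "(\<lambda>\<omega>. (X \<omega>, Y \<omega>)) -` (S \<times> S') \<inter> space M
      = (X -` S \<inter> space M) \<inter> (Y -` S' \<inter> space M)"
    by auto
  ultimately show "emeasure (distr M A X) S * emeasure (distr M B Y) S'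
      = emeasure (distr M (A \<Otimes>\<^sub>M B) (\<lambda>\<omega>. (X \<omega>, Y \<omega>))) (S \<times> S')"
    by (simp add: emeasure_distr emeasure_eq_measure ennreal_mult)
qed

lemma indep_elements_compose_left:
  assumes "prob_space M" and ind: "indep_elements M A X B Y" and f: "f \<in> measurable A A'"
  shows "indep_elements M A' (\<lambda>\<omega>. f (X \<omega>)) B Y"
proof -
  interpret prob_space M by fact
  have X: "X \<in> measurable M A"
    using ind by (simp add: indep_elements_def)
  have "{(\<lambda>\<omega>. f (X \<omega>)) -` S \<inter> space M | S. S \<in> sets A'}
      \<subseteq> {X -` S \<inter> space M | S. S \<in> sets A}"
  proof safe
    fix S assume "S \<in> sets A'"
    then have "f -` S \<inter> space A \<in> sets A"
      using f by (rule measurable_sets[rotated])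
    moreover have "(\<lambda>\<omega>. f (X \<omega>)) -` S \<inter> space M = X -` (f -` S \<inter> space A) \<inter> space M"
      using measurable_space[OF X] by auto
    ultimately show "\<exists>S'. (\<lambda>\<omega>. f (X \<omega>)) -` S \<inter> space M = X -` S' \<inter> space M \<and> S' \<in> sets A"
      by blast
  qed
  moreover have "indep_sets (case_bool {X -` S \<inter> space M | S. S \<in> sets A}
      {Y -` S \<inter> space M | S. S \<in> sets B}) UNIV"
    using ind by (simp add: indep_elements_def indep_set_def)
  ultimately have "indep_set {(\<lambda>\<omega>. f (X \<omega>)) -` S \<inter> space M | S. S \<in> sets A'}
      {Y -` S \<inter> space M | S. S \<in> sets B}"
    unfolding indep_set_def by (elim indep_sets_mono_sets) (simp split: bool.split)
  then show ?thesis
    using ind measurable_compose[OF X f] by (simp add: indep_elements_def)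
qed

text \<open>The density depends on the norm only, and Lebesgue measure is invariant under \<open>f\<close>.\<close>

lemma standard_gaussian_vector_distr_orthogonal:
  fixes v :: "'w \<Rightarrow> real ^ 'd"
  assumes v: "standard_gaussian_vector M v" and f: "orthogonal_transformation f"
  shows "distr M borel (\<lambda>\<omega>. f (v \<omega>)) = distr M borel v"
proof -
  define d where "d x = ennreal ((2 * pi) powr (- real CARD('d) / 2) * exp (- (norm x)\<^sup>2 / 2))"
    for x :: "real ^ 'd"
  have [measurable]: "f \<in> borel_measurable borel"
    by (rule borel_measurable_orthogonal_transformation[OF f])
  have [measurable]: "d \<in> borel_measurable borel"
    unfolding d_def by measurable
  have d: "distributed M lborel v d"
    using v by (simp add: standard_gaussian_vector_def d_def[abs_def])
  have [measurable]: "v \<in> borel_measurable M"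
    using distributed_measurable[OF d] by simp
  have law: "distr M borel v = density lborel d"
    using distributed_distr_eq_density[OF d] by (simp cong: distr_cong)
  have inv: "d (f x) = d x" for x
    using f by (simp add: d_def orthogonal_transformation_norm)
  have "distr M borel (\<lambda>\<omega>. f (v \<omega>)) = distr (distr M borel v) borel f"
    by (simp add: distr_distr comp_def)
  also have "\<dots> = distr (density lborel (\<lambda>x. d (f x))) borel f"
    by (simp add: law inv)
  also have "\<dots> = density (distr lborel borel f) d"
    by (rule density_distr[symmetric]) measurable
  also have "\<dots> = distr M borel v"
    by (simp add: lborel_distr_orthogonal_transformation[OF f] law)
  finally show ?thesis .
qed

text \<open>Let \<open>P\<close> and \<open>Q\<close> project onto the line through \<open>z\<close> and onto its orthogonal complement. The
  reflection \<open>f = P - Q = id - 2 Q\<close> preserves the joint law of \<open>(s, \<xi>)\<close> and the scalar \<open>\<langle>s, z\<rangle>\<close>,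
  but changes the sign of \<open>Q s\<close>. The integral is therefore equal to its own negative.\<close>

lemma gaussian_integral_orth_proj_compl_line_zero:
  fixes s :: "'w \<Rightarrow> real ^ 'd"
  assumes "prob_space M" and gauss: "standard_gaussian_vector M s"
    and ind: "indep_elements M borel s N \<xi>"
    and g [measurable]: "(\<lambda>(t, e). g t e) \<in> borel_measurable (borel \<Otimes>\<^sub>M N)"
    and z: "z \<noteq> 0"
  shows "(\<integral>\<omega>. g (s \<omega> \<bullet> z) (\<xi> \<omega>) *\<^sub>R orth_proj_compl (span {z}) (s \<omega>) \<partial>M) = 0"
proof -
  define Q where "Q = orth_proj_compl (span {z})"
  define f where "f x = x - 2 *\<^sub>R Q x" for x
  have Q_eq: "Q x = x - ((x \<bullet> z) / (norm z)\<^sup>2) *\<^sub>R z" for x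
    by (simp add: Q_def orth_proj_compl_def orth_proj_line[OF z])
  have Q_lin: "bounded_linear Q"
    unfolding Q_def by (rule bounded_linear_orth_proj_compl_line[OF z])
  interpret Q: bounded_linear Q by (rule Q_lin)
  have orth: "Q x \<bullet> z = 0" for x
    using z by (simp add: Q_eq inner_diff_left power2_norm_eq_inner)
  have QQ: "Q (Q x) = Q x" for x
    using Q_eq[of "Q x"] by (simp add: orth)
  have f_inner: "f x \<bullet> z = x \<bullet> z" for x
    by (simp add: f_def inner_diff_left orth)
  have Q_f: "Q (f x) = - Q x" for x
    by (simp add: f_def Q.diff Q.scaleR QQ vec_eq_iff)
  \<comment> \<open>\<open>Q\<close> is a self-adjoint idempotent, which is what makes \<open>id - 2 Q\<close> orthogonal.\<close>
  have sym: "x \<bullet> Q w = Q x \<bullet> Q w" for x w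
    using orth[of w] by (simp add: Q_eq[of x] inner_diff_left inner_commute[of z])
  have f_orth: "orthogonal_transformation f"
    unfolding orthogonal_transformation_def
  proof (intro conjI allI)
    show "linear f"
      by (rule linearI) (simp_all add: f_def Q.add Q.scaleR scaleR_diff_right scaleR_add_right)
    fix v w
    show "f v \<bullet> f w = v \<bullet> w"
      using sym[of v w] sym[of w v]
      by (simp add: f_def inner_diff_left inner_diff_right inner_commute)
  qed
  have [measurable]: "Q \<in> borel_measurable borel"
    by (intro borel_measurable_continuous_onI linear_continuous_on Q_lin)
  have [measurable]: "f \<in> borel_measurable borel"
    unfolding f_def by measurable
  have [measurable]: "s \<in> borel_measurable M" "\<xi> \<in> measurable M N"
    using ind by (simp_all add: indep_elements_def)
  have joint: "distr M (borel \<Otimes>\<^sub>M N) (\<lambda>\<omega>. (f (s \<omega>), \<xi> \<omega>))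
      = distr M (borel \<Otimes>\<^sub>M N) (\<lambda>\<omega>. (s \<omega>, \<xi> \<omega>))"
    using indep_elements_joint_distr[OF assms(1) ind]
      indep_elements_joint_distr[OF assms(1) indep_elements_compose_left[OF assms(1) ind, of f borel]]
      standard_gaussian_vector_distr_orthogonal[OF gauss f_orth]
    by simp
  define F where "F = (\<lambda>(x, e). g (x \<bullet> z) e *\<^sub>R Q x)"
  have [measurable]: "(\<lambda>p. g (fst p \<bullet> z) (snd p)) \<in> borel_measurable (borel \<Otimes>\<^sub>M N)"
    using measurable_compose[OF _ g, of "\<lambda>p. (fst p \<bullet> z, snd p)" "borel \<Otimes>\<^sub>M N"] by simp
  have [measurable]: "F \<in> borel_measurable (borel \<Otimes>\<^sub>M N)"
    unfolding F_def case_prod_beta by measurable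
  have "(\<integral>\<omega>. F (s \<omega>, \<xi> \<omega>) \<partial>M) = (\<integral>p. F p \<partial>distr M (borel \<Otimes>\<^sub>M N) (\<lambda>\<omega>. (s \<omega>, \<xi> \<omega>)))"
    by (rule integral_distr[symmetric]) measurable
  also have "\<dots> = (\<integral>\<omega>. F (f (s \<omega>), \<xi> \<omega>) \<partial>M)"
    unfolding joint[symmetric] by (rule integral_distr) measurable
  also have "\<dots> = - (\<integral>\<omega>. F (s \<omega>, \<xi> \<omega>) \<partial>M)"
    by (simp add: F_def f_inner Q_f)
  finally have "(\<integral>\<omega>. F (s \<omega>, \<xi> \<omega>) \<partial>M) = 0"
    by (simp add: eq_neg_iff_add_eq_0 flip: scaleR_2)
  then show ?thesis
    by (simp add: F_def Q_def)
qed

section \<open>The minimizer\<close>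

theorem proposition3p3:
  fixes M :: "'w measure"
    and s :: "'w \<Rightarrow> real ^ 'd"
    and N :: "'e measure"
    and \<xi> :: "'w \<Rightarrow> 'e"
    and g :: "real \<Rightarrow> 'e \<Rightarrow> real"
    and z0 :: "real ^ 'd"
  defines "y \<equiv> \<lambda>\<omega>. g (s \<omega> \<bullet> z0) (\<xi> \<omega>)"
    and "T \<equiv> span {z0}"
    and "\<mu> \<equiv> 1 / (norm z0)\<^sup>2 * (\<integral>\<omega>. g (s \<omega> \<bullet> z0) (\<xi> \<omega>) * (s \<omega> \<bullet> z0) \<partial>M)"
  assumes "prob_space M"
    and "sub_gaussian_vector M s"
    and "centered M s"
    and "isotropic M s"
    and "z0 \<noteq> 0"
    and "(\<lambda>(t, e). g t e) \<in> borel_measurable (borel \<Otimes>\<^sub>M N)"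
    and "indep_elements M borel s N \<xi>"
    and "sub_gaussian M y"
  shows "\<mu> *\<^sub>R z0 \<in> T
    \<and> is_arg_min (mismatch_covariance M s y) (\<lambda>z. z \<in> T) (\<mu> *\<^sub>R z0)
    \<and> mismatch_covariance M s y (\<mu> *\<^sub>R z0)
        = norm (\<integral>\<omega>. g (s \<omega> \<bullet> z0) (\<xi> \<omega>) *\<^sub>R orth_proj_compl (span {z0}) (s \<omega>) \<partial>M)
    \<and> (standard_gaussian_vector M s \<longrightarrow> mismatch_covariance M s y (\<mu> *\<^sub>R z0) = 0)"
proof -
  define a where "a = (\<integral>\<omega>. y \<omega> *\<^sub>R s \<omega> \<partial>M)"
  have int: "integrable M (\<lambda>\<omega>. y \<omega> *\<^sub>R s \<omega>)"
    using assms
    by (intro integrable_scaleR_of_squares sub_gaussian_square_integrable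
        isotropic_norm_square_integrable)
      (auto simp: sub_gaussian_def sub_gaussian_vector_def)
  have \<rho>: "mismatch_covariance M s y z = norm (a - z)" for z
    unfolding a_def by (rule mismatch_covariance_eq_dist[OF \<open>isotropic M s\<close> int])
  have "a \<bullet> z0 = (\<integral>\<omega>. y \<omega> * (s \<omega> \<bullet> z0) \<partial>M)"
    using integral_inner_left[OF int, of z0] by (simp add: a_def)
  then have \<mu>: "\<mu> = (a \<bullet> z0) / (norm z0)\<^sup>2"
    by (simp add: \<mu>_def y_def)
  have residual: "a - \<mu> *\<^sub>R z0 = orth_proj_compl T a"
    using \<open>z0 \<noteq> 0\<close> by (simp add: \<mu> T_def orth_proj_compl_def orth_proj_line)
  have lin: "bounded_linear (orth_proj_compl T)"
    unfolding T_def using \<open>z0 \<noteq> 0\<close> by (rule bounded_linear_orth_proj_compl_line)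
  have compl: "orth_proj_compl T a = (\<integral>\<omega>. y \<omega> *\<^sub>R orth_proj_compl T (s \<omega>) \<partial>M)"
    using integral_bounded_linear[OF lin int]
    by (simp add: a_def linear_cmul[OF bounded_linear.linear[OF lin]])
  have mem: "\<mu> *\<^sub>R z0 \<in> T"
    by (simp add: T_def span_base span_scale)
  moreover have "is_arg_min (mismatch_covariance M s y) (\<lambda>z. z \<in> T) (\<mu> *\<^sub>R z0)"
    using mem norm_orth_proj_compl_line_le[OF \<open>z0 \<noteq> 0\<close>, of _ a]
    by (auto simp: is_arg_min_linorder \<rho> residual T_def)
  moreover have minimum: "mismatch_covariance M s y (\<mu> *\<^sub>R z0)
      = norm (\<integral>\<omega>. g (s \<omega> \<bullet> z0) (\<xi> \<omega>) *\<^sub>R orth_proj_compl (span {z0}) (s \<omega>) \<partial>M)"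
    unfolding \<rho> residual compl by (simp add: y_def T_def)
  moreover have "mismatch_covariance M s y (\<mu> *\<^sub>R z0) = 0" if "standard_gaussian_vector M s"
    unfolding minimum using gaussian_integral_orth_proj_compl_line_zero[OF assms(4) that assms(10,9,8)]
    by simp
  ultimately show ?thesis
    by blast
qed

end
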